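(* There are no reddening sequences for the quiver $X_7$.
   Context: **The quiver $X_7$.** It has vertices $0,1,\dots,6$ and, for each $i\in\{1,2,3\}$, arrows $\alpha_i:0\to 2i-1$, $\beta_i:2i-1\to 2i$, $\delta_i:2i-1\to 2i$, $\gamma_i:2i\to 0$. **Quiver mutation.** For a quiver $Q$ without loops and 2-cycles and a vertex $k$, $\mu_k(Q)$ is obtained by: adding an arrow $i\to j$ for each path $i\to k\to j$; reversing all arrows incident to $k$; removing a maximal set of disjoint 2-cycles. **Reddening sequences.** Let $Q$ be a quiver without loops and 2-cycles. The framed quiver $\widehat Q$ is obtained from $Q$ by adding, for each vertex $i$ of $Q$, a new vertex $i'$ (called frozen) and a new arrow $i\to i'$. Mutations are performed only at non-frozen vertices. In a quiver $R$ obtained from $\widehat Q$ by finitely many mutations at non-frozen vertices, a non-frozen vertex $i$ is green if there are no arrows $j'\to i$ from any frozen vertex to $i$, and red if there are no arrows $i\to j'$ from $i$ to any frozen vertex. A sequence of non-frozen vertices $i_1,\dots,i_m$ is a reddening sequence for $Q$ if all non-frozen vertices in $\mu_{i_m}\cdots\mu_{i_2}\mu_{i_1}(\widehat Q)$ are red. *)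

theory Defs
  imports "HOL-Library.Multiset"
begin

text \<open>
  An arrow is recorded by its pair (source, target), and parallel arrows by the multiplicity of
  this pair. This is the datum of a finite quiver up to renaming of arrows, which is all that
  mutation can see: the maximal set of disjoint 2-cycles it removes is only determined up to
  such a renaming.
\<close>

record 'v quiver =
  verts :: "'v set"
  arrows :: "('v \<times> 'v) multiset"

definition no_loops_2cycles :: "'v quiver \<Rightarrow> bool" where
  "no_loops_2cycles Q \<longleftrightarrow>
     finite (verts Q) \<and> set_mset (arrows Q) \<subseteq> verts Q \<times> verts Q \<and>
     (\<forall>i j. (i, j) \<in># arrows Q \<longrightarrow> i \<noteq> j \<and> (j, i) \<notin># arrows Q)"

definition add_paths :: "'v \<Rightarrow> ('v \<times> 'v) multiset \<Rightarrow> ('v \<times> 'v) multiset" where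
  "add_paths k A =
     A + (\<Sum>a \<in># {# a \<in># A. snd a = k #}. {# (fst a, snd b). b \<in># {# b \<in># A. fst b = k #} #})"

definition reverse_at :: "'v \<Rightarrow> ('v \<times> 'v) multiset \<Rightarrow> ('v \<times> 'v) multiset" where
  "reverse_at k A = image_mset (\<lambda>(i, j). if i = k \<or> j = k then (j, i) else (i, j)) A"

text \<open>
  For vertices i and j that are joined by m arrows in one direction and n in the other,
  a maximal set of disjoint 2-cycles uses min m n arrows of either direction, so the difference
  below (truncated at 0) leaves m - n, resp. n - m. It would also delete loops, but none arise
  when a quiver without loops and 2-cycles is mutated.
\<close>

definition cancel_2cycles :: "('v \<times> 'v) multiset \<Rightarrow> ('v \<times> 'v) multiset" where
  "cancel_2cycles A = A - image_mset prod.swap A"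

definition mutate :: "'v \<Rightarrow> 'v quiver \<Rightarrow> 'v quiver" where
  "mutate k Q = Q\<lparr>arrows := cancel_2cycles (reverse_at k (add_paths k (arrows Q)))\<rparr>"

datatype 'v framed_vertex = Mutable 'v | Frozen 'v

definition framed :: "'v quiver \<Rightarrow> 'v framed_vertex quiver" where
  "framed Q =
     \<lparr>verts = Mutable ` verts Q \<union> Frozen ` verts Q,
      arrows = image_mset (map_prod Mutable Mutable) (arrows Q) +
               image_mset (\<lambda>i. (Mutable i, Frozen i)) (mset_set (verts Q))\<rparr>"

definition green :: "'v framed_vertex quiver \<Rightarrow> 'v \<Rightarrow> bool" where
  "green R i \<longleftrightarrow> (\<forall>j. (Frozen j, Mutable i) \<notin># arrows R)"

definition red :: "'v framed_vertex quiver \<Rightarrow> 'v \<Rightarrow> bool" where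
  "red R i \<longleftrightarrow> (\<forall>j. (Mutable i, Frozen j) \<notin># arrows R)"

text \<open>The head of the list is the vertex mutated first.\<close>

definition reddening_sequence :: "'v quiver \<Rightarrow> 'v list \<Rightarrow> bool" where
  "reddening_sequence Q ks \<longleftrightarrow>
     set ks \<subseteq> verts Q \<and>
     (\<forall>i \<in> verts Q. red (fold (\<lambda>k. mutate (Mutable k)) ks (framed Q)) i)"

definition X7 :: "nat quiver" where
  "X7 =
     \<lparr>verts = {0..6},
      arrows = (\<Sum>i\<in>{1, 2, 3}. {# (0, 2*i - 1), (2*i - 1, 2*i), (2*i - 1, 2*i), (2*i, 0) #})\<rparr>"

lemma X7_no_loops_2cycles: "no_loops_2cycles X7"
  by (auto simp: no_loops_2cycles_def X7_def)

end

theory Submission imports Defs begin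

text \<open>
  Let B be the skew-symmetric matrix of a quiver and let w be a weighting of its vertices that is
  balanced: at every vertex k, the arrows into k and the arrows out of k carry the same total
  weight s(k). Replacing w(k) by s(k) - w(k) when mutating at k preserves the sum of w(i) times
  the number of arrows from i to a fixed frozen vertex, counted with sign; because of the balance
  no sign-coherence of these numbers is needed. On X7 the weighting (2, 1, 1, 1, 1, 1, 1) is
  balanced. Mutation at 0 turns it into a second quiver on which the constant weighting 1 is
  balanced, and up to relabelling no further weighted quivers arise. So the weights stay positive
  and the weighted sum for the frozen vertex 0' stays equal to 2, whereas it would be at most 0 if
  all vertices were red.
\<close>

section \<open>Mutation of skew-symmetric matrices\<close>

definition skew :: "('v \<times> 'v) multiset \<Rightarrow> 'v \<Rightarrow> 'v \<Rightarrow> int" where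
  "skew A i j = int (count A (i, j)) - int (count A (j, i))"

text \<open>This is the Fomin-Zelevinsky matrix mutation. For skew-symmetric \<open>B\<close> the
  two products count paths i -> k -> j and j -> k -> i.\<close>

definition mutate_matrix :: "'v \<Rightarrow> ('v \<Rightarrow> 'v \<Rightarrow> int) \<Rightarrow> 'v \<Rightarrow> 'v \<Rightarrow> int" where
  "mutate_matrix k B i j =
     (if i = k \<or> j = k then - B i j
      else B i j + max 0 (B i k) * max 0 (B k j) - max 0 (B j k) * max 0 (B k i))"

text \<open>The case \<open>i = j\<close> rules out loops along with 2-cycles.\<close>

definition reduced :: "('v \<times> 'v) multiset \<Rightarrow> bool" where
  "reduced A \<longleftrightarrow> (\<forall>i j. (i, j) \<in># A \<longrightarrow> (j, i) \<notin># A)"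

lemma skew_swap: "skew A j i = - skew A i j"
  by (simp add: skew_def)

text \<open>A reduced quiver is recovered from its signed matrix, so path counts turn into the
  products of positive parts in \<open>mutate_matrix\<close>.\<close>

lemma count_conv_skew:
  assumes "reduced A"
  shows "int (count A (i, j)) = max 0 (skew A i j)"
proof -
  have "count A (i, j) = 0 \<or> count A (j, i) = 0"
    using assms by (auto simp: reduced_def not_in_iff)
  then show ?thesis by (auto simp: skew_def)
qed

lemma count_paths:
  "count (\<Sum>a \<in># {# a \<in># A. snd a = k #}. {# (fst a, snd b). b \<in># {# b \<in># C. fst b = k #} #}) (i, j) =
   count A (i, k) * count C (k, j)"
proof -
  have "count {# (x, snd b). b \<in># {# b \<in># C. fst b = k #} #} (i, j) = (if x = i then count C (k, j) else 0)"
    for x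
    by (induction C) auto
  then show ?thesis
    by (induction A) auto
qed

lemma count_add_paths:
  "count (add_paths k A) (i, j) = count A (i, j) + count A (i, k) * count A (k, j)"
  by (simp add: add_paths_def count_paths)

lemma count_image_mset_unique_preimage:
  assumes "\<And>p. f p = y \<longleftrightarrow> p = x"
  shows "count (image_mset f A) y = count A x"
  by (induction A) (simp_all add: assms)

text \<open>Reversal at \<open>k\<close> is an involution on pairs, so every pair has exactly one
  preimage.\<close>

lemma count_reverse_at:
  "count (reverse_at k A) (i, j) = (if i = k \<or> j = k then count A (j, i) else count A (i, j))"
proof -
  have "count (reverse_at k A) (i, j) = count A (if i = k \<or> j = k then (j, i) else (i, j))"
    unfolding reverse_at_def
    by (rule count_image_mset_unique_preimage) (auto split: if_splits)
  then show ?thesis by simp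
qed

lemma count_image_mset_swap: "count (image_mset prod.swap A) (i, j) = count A (j, i)"
  by (rule count_image_mset_unique_preimage) auto

lemma count_cancel_2cycles:
  "count (cancel_2cycles A) (i, j) = count A (i, j) - count A (j, i)"
  by (simp add: cancel_2cycles_def count_image_mset_swap)

lemma reduced_cancel_2cycles: "reduced (cancel_2cycles A)"
  unfolding reduced_def not_in_iff count_greater_zero_iff[symmetric] count_cancel_2cycles by simp

lemma skew_cancel_2cycles: "skew (cancel_2cycles A) = skew A"
  by (intro ext) (simp add: skew_def count_cancel_2cycles)

lemma reduced_mutate: "reduced (arrows (mutate k Q))"
  by (simp add: mutate_def reduced_cancel_2cycles)

lemma skew_mutate:
  assumes "reduced (arrows Q)"
  shows "skew (arrows (mutate k Q)) = mutate_matrix k (skew (arrows Q))"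
proof (intro ext)
  fix i j
  let ?A = "arrows Q"
  \<comment> \<open>With no loop at \<open>k\<close>, no path through \<open>k\<close> adds an arrow
    incident to \<open>k\<close>; entries in row or column \<open>k\<close> only change
    sign.\<close>
  have "count ?A (k, k) = 0"
    using assms by (metis reduced_def not_in_iff)
  moreover have "skew (arrows (mutate k Q)) i j = skew (reverse_at k (add_paths k ?A)) i j"
    by (simp add: mutate_def skew_cancel_2cycles)
  ultimately show "skew (arrows (mutate k Q)) i j = mutate_matrix k (skew ?A) i j"
    by (auto simp: mutate_matrix_def count_reverse_at count_add_paths
        skew_def[of "reverse_at k B" for B] skew_def[of ?A i j] count_conv_skew[OF assms, symmetric])
qed

section \<open>Balanced weights\<close>

definition balanced_at :: "'v set \<Rightarrow> ('v \<Rightarrow> 'v \<Rightarrow> int) \<Rightarrow> ('v \<Rightarrow> int) \<Rightarrow> 'v \<Rightarrow> bool" where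
  "balanced_at V B w k \<longleftrightarrow> (\<Sum>i\<in>V. w i * max 0 (B i k)) = (\<Sum>i\<in>V. w i * max 0 (B k i))"

definition mutate_weight :: "'v set \<Rightarrow> ('v \<Rightarrow> 'v \<Rightarrow> int) \<Rightarrow> 'v \<Rightarrow> ('v \<Rightarrow> int) \<Rightarrow> 'v \<Rightarrow> int" where
  "mutate_weight V B k w = w(k := (\<Sum>i\<in>V. w i * max 0 (B i k)) - w k)"

text \<open>Let s be the common weight of the two sides at \<open>k\<close>. The terms with i
  different from k gain s * \<open>B k f\<close> in total, and the term at \<open>k\<close> loses
  the same amount, since (s - \<open>w k\<close>) * (- \<open>B k f\<close>) =
  \<open>w k * B k f\<close> - s * \<open>B k f\<close>.\<close>

lemma weighted_sum_mutate:
  assumes "finite V" "k \<in> V" "f \<noteq> k"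
    and skew: "\<And>i j. B j i = - B i j"
    and bal: "balanced_at V B w k"
  shows "(\<Sum>i\<in>V. mutate_weight V B k w i * mutate_matrix k B i f) = (\<Sum>i\<in>V. w i * B i f)"
proof -
  let ?V = "V - {k}"
  define s where "s = (\<Sum>i\<in>V. w i * max 0 (B i k))"
  have "B k k = 0" using skew[of k k] by simp
  then have s_in: "s = (\<Sum>i\<in>?V. w i * max 0 (B i k))"
    and s_out: "s = (\<Sum>i\<in>?V. w i * max 0 (B k i))"
    using assms(1,2) bal by (simp_all add: s_def balanced_at_def sum.remove[of V k])
  have "(\<Sum>i\<in>V. mutate_weight V B k w i * mutate_matrix k B i f) =
      (s - w k) * (- B k f) + (\<Sum>i\<in>?V. mutate_weight V B k w i * mutate_matrix k B i f)"
    using assms(1,2) by (simp add: sum.remove[of V k] mutate_matrix_def mutate_weight_def s_def)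
  also have "(\<Sum>i\<in>?V. mutate_weight V B k w i * mutate_matrix k B i f) =
      (\<Sum>i\<in>?V. w i * B i f + (w i * max 0 (B i k)) * max 0 (B k f)
         - (w i * max 0 (B k i)) * max 0 (B f k))"
    using assms(3)
    by (intro sum.cong) (auto simp: mutate_matrix_def mutate_weight_def algebra_simps)
  \<comment> \<open>Balance enters here: the incoming and the outgoing sums are both s, so the two
    positive parts combine into \<open>B k f\<close>.\<close>
  also have "\<dots> = (\<Sum>i\<in>?V. w i * B i f) + s * max 0 (B k f) - s * max 0 (B f k)"
    unfolding s_out[symmetric] s_in[symmetric] sum.distrib sum_subtractf sum_distrib_right[symmetric]
    by simp
  also have "\<dots> = (\<Sum>i\<in>?V. w i * B i f) + s * B k f"
    using skew[of f k] by (simp add: max_def)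
  finally show ?thesis
    using assms(1,2) by (simp add: sum.remove[of V k] algebra_simps)
qed

section \<open>The mutation class of X7\<close>

text \<open>The first entry is X7 in its own numbering; the second is its mutation at 0. Lists keep
  the closure check executable.\<close>

definition weighted_quivers :: "(int list list \<times> int list) list" where
  "weighted_quivers =
    [([[0, 1, -1, 1, -1, 1, -1],
       [-1, 0, 2, 0, 0, 0, 0],
       [1, -2, 0, 0, 0, 0, 0],
       [-1, 0, 0, 0, 2, 0, 0],
       [1, 0, 0, -2, 0, 0, 0],
       [-1, 0, 0, 0, 0, 0, 2],
       [1, 0, 0, 0, 0, -2, 0]],
      [2, 1, 1, 1, 1, 1, 1]),
     ([[0, -1, 1, -1, 1, -1, 1],
       [1, 0, 1, 0, -1, 0, -1],
       [-1, -1, 0, 1, 0, 1, 0],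
       [1, 0, -1, 0, 1, 0, -1],
       [-1, 1, 0, -1, 0, 1, 0],
       [1, 0, -1, 0, -1, 0, 1],
       [-1, 1, 0, 1, 0, -1, 0]],
      [1, 1, 1, 1, 1, 1, 1])]"

text \<open>\<open>t ! i\<close> is the vertex that moves to position i. The identity serves
  mutation at 0, in both directions; the three transpositions serve X7 at the two ends of a double
  arrow. The last six serve the second quiver at k = 1, ..., 6, where the partner of k in {1,2},
  {3,4} or {5,6} becomes the vertex of degree six, placed at position 0.\<close>

definition relabellings :: "nat list list" where
  "relabellings =
    [[0, 1, 2, 3, 4, 5, 6],
     [0, 2, 1, 3, 4, 5, 6],
     [0, 1, 2, 4, 3, 5, 6],
     [0, 1, 2, 3, 4, 6, 5],
     [2, 0, 1, 4, 5, 6, 3],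
     [1, 2, 0, 4, 5, 6, 3],
     [4, 0, 3, 2, 5, 6, 1],
     [3, 2, 5, 4, 0, 6, 1],
     [6, 0, 5, 2, 3, 4, 1],
     [5, 2, 3, 4, 1, 6, 0]]"

text \<open>A finite computation with 14 cases, two quivers and seven vertices each; one relabelling
  has to match matrix and weights at once.\<close>

lemma weighted_quivers_closed_code:
  "list_all (\<lambda>(B, w). list_all (\<lambda>k.
      (\<Sum>i\<leftarrow>[0..<7]. w ! i * max 0 (B ! i ! k)) = (\<Sum>i\<leftarrow>[0..<7]. w ! i * max 0 (B ! k ! i)) \<and>
      list_ex (\<lambda>t. list_ex (\<lambda>(B', w').
        list_all (\<lambda>i.
          (w[k := (\<Sum>i\<leftarrow>[0..<7]. w ! i * max 0 (B ! i ! k)) - w ! k]) ! (t ! i) = w' ! i \<and>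
          list_all (\<lambda>j. mutate_matrix k (\<lambda>i j. B ! i ! j) (t ! i) (t ! j) = B' ! i ! j) [0..<7])
        [0..<7]) weighted_quivers) relabellings) [0..<7]) weighted_quivers"
  by code_simp

lemma weighted_quivers_closed:
  assumes "(M, u) \<in> set weighted_quivers" "k < 7"
  defines "s \<equiv> (\<Sum>i<7. u ! i * max 0 (M ! i ! k))"
  shows "s = (\<Sum>i<7. u ! i * max 0 (M ! k ! i))"
    and "\<exists>t \<in> set relabellings. \<exists>(M', u') \<in> set weighted_quivers. \<forall>i<7.
           (u[k := s - u ! k]) ! (t ! i) = u' ! i \<and>
           (\<forall>j<7. mutate_matrix k (\<lambda>i j. M ! i ! j) (t ! i) (t ! j) = M' ! i ! j)"
proof -
  have sum_upt: "(\<Sum>i\<leftarrow>[0..<7]. g i) = (\<Sum>i<7. g i)" for g :: "nat \<Rightarrow> int"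
    by (simp only: interv_sum_list_conv_sum_set_nat set_upt atLeast0LessThan)
  have "k \<in> {..<7}" using assms(2) by simp
  from bspec[OF bspec[OF weighted_quivers_closed_code
        [unfolded list_all_iff list_ex_iff sum_upt set_upt atLeast0LessThan] assms(1),
        unfolded prod.case] this]
  show "s = (\<Sum>i<7. u ! i * max 0 (M ! k ! i))"
    and "\<exists>t \<in> set relabellings. \<exists>(M', u') \<in> set weighted_quivers. \<forall>i<7.
           (u[k := s - u ! k]) ! (t ! i) = u' ! i \<and>
           (\<forall>j<7. mutate_matrix k (\<lambda>i j. M ! i ! j) (t ! i) (t ! j) = M' ! i ! j)"
    unfolding s_def Ball_def lessThan_iff by (blast+)
qed

lemma bij_betw_relabelling:
  assumes "t \<in> set relabellings"
  shows "bij_betw ((!) t) {..<7} {..<7}"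
proof -
  have "\<forall>t \<in> set relabellings. distinct t \<and> length t = 7 \<and> set t = {0, 1, 2, 3, 4, 5, 6}"
    by (simp add: relabellings_def insert_commute)
  moreover have "{0, 1, 2, 3, 4, 5, 6} = {..<7 :: nat}"
    by auto
  ultimately show ?thesis
    using assms by (intro bij_betw_nth) auto
qed

lemma weighted_quivers_length:
  "(M, u) \<in> set weighted_quivers \<Longrightarrow> length u = 7"
  by (auto simp: weighted_quivers_def)

lemma weighted_quivers_pos:
  "(M, u) \<in> set weighted_quivers \<Longrightarrow> i < 7 \<Longrightarrow> 0 < u ! i"
  by (auto simp: weighted_quivers_def less_Suc_eq numeral_eq_Suc)

text \<open>\<open>\<sigma>\<close> sends list positions to vertices. Only entries of
  \<open>B\<close> inside \<open>V\<close> are constrained, so arrows to frozen vertices remain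
  free.\<close>

definition in_X7_class :: "'v set \<Rightarrow> ('v \<Rightarrow> 'v \<Rightarrow> int) \<Rightarrow> ('v \<Rightarrow> int) \<Rightarrow> bool" where
  "in_X7_class V B w \<longleftrightarrow>
     (\<exists>\<sigma>. bij_betw \<sigma> {..<7} V \<and> (\<exists>(M, u) \<in> set weighted_quivers.
        \<forall>i<7. w (\<sigma> i) = u ! i \<and> (\<forall>j<7. B (\<sigma> i) (\<sigma> j) = M ! i ! j)))"

lemma in_X7_class_pos:
  assumes "in_X7_class V B w" "i \<in> V"
  shows "0 < w i"
proof -
  obtain \<sigma> M u where \<sigma>: "bij_betw \<sigma> {..<7} V" and "(M, u) \<in> set weighted_quivers"
    and "\<forall>i<7. w (\<sigma> i) = u ! i"
    using assms(1) unfolding in_X7_class_def by blast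
  moreover obtain j where "j < 7" "i = \<sigma> j"
    using assms(2) \<sigma> by (auto simp: bij_betw_def)
  ultimately show ?thesis
    using weighted_quivers_pos by metis
qed

lemma in_X7_class_mutate:
  assumes "in_X7_class V B w" "k \<in> V"
  shows "balanced_at V B w k"
    and "in_X7_class V (mutate_matrix k B) (mutate_weight V B k w)"
proof -
  obtain \<sigma> M u where \<sigma>: "bij_betw \<sigma> {..<7} V" and Mu: "(M, u) \<in> set weighted_quivers"
    and w: "\<And>i. i < 7 \<Longrightarrow> w (\<sigma> i) = u ! i"
    and B: "\<And>i j. i < 7 \<Longrightarrow> j < 7 \<Longrightarrow> B (\<sigma> i) (\<sigma> j) = M ! i ! j"
    using assms(1) unfolding in_X7_class_def by blast
  obtain l where l: "l < 7" "k = \<sigma> l"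
    using assms(2) \<sigma> by (auto simp: bij_betw_def)
  define s where "s = (\<Sum>i<7. u ! i * max 0 (M ! i ! l))"
  have s_in: "(\<Sum>i\<in>V. w i * max 0 (B i k)) = s"
    unfolding s_def sum.reindex_bij_betw[OF \<sigma>, symmetric] by (intro sum.cong) (auto simp: w B l)
  have "(\<Sum>i\<in>V. w i * max 0 (B k i)) = (\<Sum>i<7. u ! i * max 0 (M ! l ! i))"
    unfolding sum.reindex_bij_betw[OF \<sigma>, symmetric] by (intro sum.cong) (auto simp: w B l)
  then show "balanced_at V B w k"
    using weighted_quivers_closed(1)[OF Mu l(1)] s_in by (simp add: balanced_at_def s_def)
  \<comment> \<open>Injectivity of \<open>\<sigma>\<close> lets the case distinctions in
    \<open>mutate_weight\<close> and \<open>mutate_matrix\<close> pass to positions.\<close>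
  have \<sigma>_eq: "\<sigma> i = k \<longleftrightarrow> i = l" if "i < 7" for i
    using \<sigma> that l by (auto simp: bij_betw_def inj_on_def)
  have w': "mutate_weight V B k w (\<sigma> i) = (u[l := s - u ! l]) ! i" if "i < 7" for i
    using that l(1) \<sigma>_eq[OF that] weighted_quivers_length[OF Mu] w[OF that]
    by (auto simp: mutate_weight_def s_in nth_list_update)
  have B': "mutate_matrix k B (\<sigma> i) (\<sigma> j) = mutate_matrix l (\<lambda>i j. M ! i ! j) i j"
    if "i < 7" "j < 7" for i j
    using that l \<sigma>_eq by (auto simp: mutate_matrix_def B)
  obtain t M' u' where t: "t \<in> set relabellings" and Mu': "(M', u') \<in> set weighted_quivers"
    and closed: "\<forall>i<7. (u[l := s - u ! l]) ! (t ! i) = u' ! i \<and>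
      (\<forall>j<7. mutate_matrix l (\<lambda>i j. M ! i ! j) (t ! i) (t ! j) = M' ! i ! j)"
    using weighted_quivers_closed(2)[OF Mu l(1)] unfolding s_def by blast
  note bij_t = bij_betw_relabelling[OF t]
  then have "t ! i < 7" if "i < 7" for i
    using that by (auto simp: bij_betw_def)
  then have "\<forall>i<7. mutate_weight V B k w ((\<sigma> \<circ> (!) t) i) = u' ! i \<and>
      (\<forall>j<7. mutate_matrix k B ((\<sigma> \<circ> (!) t) i) ((\<sigma> \<circ> (!) t) j) = M' ! i ! j)"
    using closed by (simp add: w' B')
  \<comment> \<open>The new labelling first permutes positions by \<open>t\<close> and then applies
    the old \<open>\<sigma>\<close>.\<close>
  then show "in_X7_class V (mutate_matrix k B) (mutate_weight V B k w)"
    unfolding in_X7_class_def using bij_betw_trans[OF bij_t \<sigma>] Mu' by blast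
qed

section \<open>The invariant along mutation sequences and the conclusion\<close>

definition X7_invariant :: "nat framed_vertex quiver \<Rightarrow> bool" where
  "X7_invariant R \<longleftrightarrow> reduced (arrows R) \<and>
     (\<exists>w. in_X7_class (Mutable ` verts X7) (skew (arrows R)) w \<and>
          (\<Sum>i \<in> Mutable ` verts X7. w i * skew (arrows R) i (Frozen 0)) = 2)"

lemma arrows_framed_X7:
  "arrows (framed X7) =
     {# (Mutable 0, Mutable 1), (Mutable 1, Mutable 2), (Mutable 1, Mutable 2), (Mutable 2, Mutable 0),
        (Mutable 0, Mutable 3), (Mutable 3, Mutable 4), (Mutable 3, Mutable 4), (Mutable 4, Mutable 0),
        (Mutable 0, Mutable 5), (Mutable 5, Mutable 6), (Mutable 5, Mutable 6), (Mutable 6, Mutable 0),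
        (Mutable 0, Frozen 0), (Mutable 1, Frozen 1), (Mutable 2, Frozen 2), (Mutable 3, Frozen 3),
        (Mutable 4, Frozen 4), (Mutable 5, Frozen 5), (Mutable 6, Frozen 6) #}"
proof -
  have "{0..6} = {0, 1, 2, 3, 4, 5, 6 :: nat}"
    by auto
  then show ?thesis
    by (simp add: framed_def X7_def)
qed

text \<open>The constant 2 is the weight of vertex 0: the only arrow at \<open>Frozen 0\<close> in
  the framed quiver comes from \<open>Mutable 0\<close>.\<close>

lemma X7_invariant_framed: "X7_invariant (framed X7)"
proof -
  let ?B = "skew (arrows (framed X7))"
  obtain M u where Mu: "(M, u) = weighted_quivers ! 0"
    by (metis surj_pair)
  define w where "w = (\<lambda>i. case i of Mutable j \<Rightarrow> u ! j | Frozen j \<Rightarrow> 0)"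
  have V: "verts X7 = {..<7}"
    by (auto simp: X7_def)
  have "bij_betw Mutable {..<7} (Mutable ` verts X7)"
    unfolding V by (simp add: bij_betw_def inj_on_def)
  moreover have "(M, u) \<in> set weighted_quivers"
    by (simp add: Mu weighted_quivers_def)
  moreover have "\<forall>i<7. w (Mutable i) = u ! i \<and> (\<forall>j<7. ?B (Mutable i) (Mutable j) = M ! i ! j)"
    using Mu
    by (auto simp: w_def weighted_quivers_def skew_def arrows_framed_X7 numeral_eq_Suc All_less_Suc)
  ultimately have "in_X7_class (Mutable ` verts X7) ?B w"
    unfolding in_X7_class_def by blast
  moreover have "(\<Sum>i \<in> Mutable ` verts X7. w i * ?B i (Frozen 0)) = 2"
    using Mu unfolding V
    by (simp add: sum.reindex inj_on_def w_def weighted_quivers_def skew_def arrows_framed_X7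
        numeral_eq_Suc)
  moreover have "reduced (arrows (framed X7))"
    by (auto simp: reduced_def arrows_framed_X7)
  ultimately show ?thesis
    unfolding X7_invariant_def by blast
qed

text \<open>The weighting changes with each mutation, hence the existential quantifier in the
  invariant; \<open>mutate_weight\<close> supplies the next witness.\<close>

lemma X7_invariant_mutate:
  assumes "X7_invariant R" "k \<in> verts X7"
  shows "X7_invariant (mutate (Mutable k) R)"
proof -
  let ?V = "Mutable ` verts X7" and ?B = "skew (arrows R)" and ?k = "Mutable k"
  obtain w where red: "reduced (arrows R)" and cls: "in_X7_class ?V ?B w"
    and sum: "(\<Sum>i\<in>?V. w i * ?B i (Frozen 0)) = 2"
    using assms(1) unfolding X7_invariant_def by blast
  have k: "?k \<in> ?V" using assms(2) by simp
  have "finite ?V" by (simp add: X7_def)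
  then have "(\<Sum>i\<in>?V. mutate_weight ?V ?B ?k w i * mutate_matrix ?k ?B i (Frozen 0)) = 2"
    using weighted_sum_mutate[of ?V ?k "Frozen 0" ?B w, OF _ k _ skew_swap in_X7_class_mutate(1)[OF cls k]]
      sum by simp
  then show ?thesis
    unfolding X7_invariant_def skew_mutate[OF red]
    using in_X7_class_mutate(2)[OF cls k] reduced_mutate[of ?k R] by blast
qed

lemma X7_invariant_imp_not_red:
  assumes "X7_invariant R"
  shows "\<exists>i \<in> verts X7. \<not> red R i"
proof (rule ccontr)
  assume "\<not> (\<exists>i \<in> verts X7. \<not> red R i)"
  then have red: "red R i" if "i \<in> verts X7" for i
    using that by blast
  let ?V = "Mutable ` verts X7"
  obtain w where cls: "in_X7_class ?V (skew (arrows R)) w"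
    and sum: "(\<Sum>i\<in>?V. w i * skew (arrows R) i (Frozen 0)) = 2"
    using assms unfolding X7_invariant_def by blast
  have "w i * skew (arrows R) i (Frozen 0) \<le> 0" if i: "i \<in> ?V" for i
  proof -
    have "count (arrows R) (i, Frozen 0) = 0"
      using i red by (auto simp: red_def not_in_iff)
    then have "skew (arrows R) i (Frozen 0) \<le> 0"
      by (simp add: skew_def)
    then show ?thesis
      using in_X7_class_pos[OF cls i] by (simp add: mult_le_0_iff)
  qed
  then have "(\<Sum>i\<in>?V. w i * skew (arrows R) i (Frozen 0)) \<le> 0"
    by (rule sum_nonpos)
  then show False using sum by simp
qed

theorem proposition5p10:
  "\<not> (\<exists>ks. reddening_sequence X7 ks)"
proof
  assume "\<exists>ks. reddening_sequence X7 ks"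
  then obtain ks where ks: "set ks \<subseteq> verts X7"
    and red: "\<forall>i \<in> verts X7. red (fold (\<lambda>k. mutate (Mutable k)) ks (framed X7)) i"
    unfolding reddening_sequence_def by blast
  \<comment> \<open>The induction varies \<open>R\<close>, since \<open>fold\<close> replaces the
    starting quiver at every step.\<close>
  have "X7_invariant (fold (\<lambda>k. mutate (Mutable k)) ks R)" if "X7_invariant R" for R
    using ks that by (induction ks arbitrary: R) (auto intro: X7_invariant_mutate)
  from X7_invariant_imp_not_red[OF this[OF X7_invariant_framed]] red show False
    by blast
qed

end
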